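(* Let $\mathcal{X},\mathcal{Y},\mathcal{Z}$ be Euclidean spaces, let $\emptyset\neq C\subset\mathcal{X}$ be a connected closed embedded submanifold of $\mathcal{X}$, and let $F:=h+g\circ\mathfrak{S}:\mathcal{X}\to\mathbb{R}$ where: $h:\mathcal{X}\to\mathbb{R}$ is continuously differentiable with $\nabla h$ Lipschitz continuous over $C$ with constant $L_{\nabla h}>0$; $\mathfrak{S}:\mathcal{X}\to\mathcal{Z}$ is continuously differentiable; $g:\mathcal{Z}\to\mathbb{R}$ is Lipschitz continuous with constant $L_g>0$ and $\eta$-weakly convex with $\eta>0$; and $\inf_{\bm{x}\in C}F(\bm{x})>-\infty$. Let $\bm{\varphi}:\mathcal{Y}\to\mathcal{X}$ be continuously differentiable with $\bm{\varphi}(\mathcal{Y})=C$. Let $\bm{x}^\star:=\bm{\varphi}(\bm{y}^\star)\in C$ with some $\bm{y}^\star\in\mathcal{Y}$. Then: (a) If $\bm{0}\in\partial_{\rm L}(F+\iota_C)(\bm{x}^\star)$, then $\bm{0}\in\partial_{\rm L}(F\circ\bm{\varphi})(\bm{y}^\star)$. (b) Assume $N_C(\bm{x}^\star)\supset\mathrm{Ker}\left((\mathrm{D}\bm{\varphi}(\bm{y}^\star))^*\right)$. If $\bm{0}\in\partial_{\rm L}(F\circ\bm{\varphi})(\bm{y}^\star)$, then $\bm{0}\in\partial_{\rm L}(F+\iota_C)(\bm{x}^\star)$.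
   Context: A Euclidean space is a finite-dimensional real Hilbert space. $g$ is $\eta$-weakly convex if $g+\frac{\eta}{2}\|\cdot\|^2$ is convex. $\iota_C(\bm{x})=0$ if $\bm{x}\in C$ and $+\infty$ otherwise. $\mathrm{D}\bm{\varphi}(\bm{y}):\mathcal{Y}\to\mathcal{X}$ is the derivative, $A^*$ the adjoint of a linear operator $A$. Embedded submanifold: $C\subset\mathcal{X}$ is a $d$-dimensional embedded submanifold if each $\bar{\bm{x}}\in C$ has an open neighborhood $\mathcal{N}_{\bar{\bm{x}}}\subset\mathcal{X}$ and a continuously differentiable $H_{\bar{\bm{x}}}:\mathcal{N}_{\bar{\bm{x}}}\to\mathbb{R}^{\dim(\mathcal{X})-d}$ with $C\cap\mathcal{N}_{\bar{\bm{x}}}=H_{\bar{\bm{x}}}^{-1}(\bm{0})$ and $\mathrm{Rank}(\mathrm{D}H_{\bar{\bm{x}}}(\bar{\bm{x}}))=\dim(\mathcal{X})-d$. Subdifferentials: for $J:\mathcal{X}\to\mathbb{R}\cup\{+\infty\}$ and $\bar{\bm{x}}$ with $J(\bar{\bm{x}})<+\infty$, the Fréchet (regular) subdifferential is $\partial_{\rm F}J(\bar{\bm{x}}):=\{\bm{v}\in\mathcal{X}\mid \liminf_{\bm{x}\to\bar{\bm{x}},\bm{x}\neq\bar{\bm{x}}}\frac{J(\bm{x})-J(\bar{\bm{x}})-\langle\bm{v},\bm{x}-\bar{\bm{x}}\rangle}{\|\bm{x}-\bar{\bm{x}}\|}\ge0\}$, and the limiting subdifferential $\partial_{\rm L}J(\bar{\bm{x}})$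 is the set of all $\bm{v}$ for which there exist $\bm{x}_n\to\bar{\bm{x}}$ with $J(\bm{x}_n)\to J(\bar{\bm{x}})$ and $\bm{v}_n\in\partial_{\rm F}J(\bm{x}_n)$ with $\bm{v}_n\to\bm{v}$. Both are empty where $J=+\infty$. The general normal cone is $N_C(\bar{\bm{x}}):=\partial_{\rm L}\iota_C(\bar{\bm{x}})$. *)

theory Defs
  imports "HOL-Analysis.Analysis"
begin

text \<open>Euclidean spaces are rendered by the class \<open>euclidean_space\<close>; a function into
  the extended line \<open>\<real> \<union> {+\<infinity>}\<close> has type \<open>'a \<Rightarrow> ereal\<close> and never takes the value
  \<open>-\<infinity>\<close>.\<close>

definition continuously_differentiable_on ::
  "'a::euclidean_space set \<Rightarrow> ('a \<Rightarrow> 'b::euclidean_space) \<Rightarrow> bool"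
  where "continuously_differentiable_on U f \<longleftrightarrow> open U \<and>
    (\<exists>f' :: 'a \<Rightarrow> 'a \<Rightarrow>\<^sub>L 'b. (\<forall>x\<in>U. (f has_derivative blinfun_apply (f' x)) (at x)) \<and>
      continuous_on U f')"

definition gradient :: "('a::euclidean_space \<Rightarrow> real) \<Rightarrow> 'a \<Rightarrow> 'a"
  where "gradient f x = (THE D. GDERIV f x :> D)"

definition weakly_convex :: "real \<Rightarrow> ('a::euclidean_space \<Rightarrow> real) \<Rightarrow> bool"
  where "weakly_convex \<eta> g \<longleftrightarrow> convex_on UNIV (\<lambda>z. g z + \<eta> / 2 * (norm z)\<^sup>2)"

text \<open>The target space \<open>\<real>\<^sup>k\<close> of the local defining function, where
  \<open>k = DIM('a) - d\<close> is not a type-level constant, is represented by a \<open>k\<close>-dimensional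
  linear subspace \<open>W\<close> of \<open>'a\<close>. The rank of a linear map is the dimension of its range.\<close>

definition embedded_submanifold :: "nat \<Rightarrow> 'a::euclidean_space set \<Rightarrow> bool"
  where "embedded_submanifold d C \<longleftrightarrow> d \<le> DIM('a) \<and>
    (\<forall>p\<in>C. \<exists>N W. \<exists>H :: 'a \<Rightarrow> 'a.
       open N \<and> p \<in> N \<and>
       subspace W \<and> dim W = DIM('a) - d \<and> H ` N \<subseteq> W \<and>
       continuously_differentiable_on N H \<and>
       C \<inter> N = {x \<in> N. H x = 0} \<and>
       dim (range (frechet_derivative H (at p))) = DIM('a) - d)"

definition set_indicator :: "'a set \<Rightarrow> 'a \<Rightarrow> ereal"
  where "set_indicator C x = (if x \<in> C then 0 else \<infinity>)"

text \<open>The filter \<open>at x\<close> excludes the point \<open>x\<close> itself.\<close>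

definition frechet_subdifferential ::
  "('a::euclidean_space \<Rightarrow> ereal) \<Rightarrow> 'a \<Rightarrow> 'a set"
  where "frechet_subdifferential J x =
    {v. J x < \<infinity> \<and>
        0 \<le> Liminf (at x) (\<lambda>y. (J y - J x - ereal (v \<bullet> (y - x))) / ereal (norm (y - x)))}"

definition limiting_subdifferential ::
  "('a::euclidean_space \<Rightarrow> ereal) \<Rightarrow> 'a \<Rightarrow> 'a set"
  where "limiting_subdifferential J x =
    {v. J x < \<infinity> \<and>
        (\<exists>xs vs. xs \<longlonglongrightarrow> x \<and> (\<lambda>n. J (xs n)) \<longlonglongrightarrow> J x \<and>
          (\<forall>n. vs n \<in> frechet_subdifferential J (xs n)) \<and> vs \<longlonglongrightarrow> v)}"

definition normal_cone :: "'a::euclidean_space set \<Rightarrow> 'a \<Rightarrow> 'a set"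
  where "normal_cone C x = limiting_subdifferential (set_indicator C) x"

definition kernel :: "('a::euclidean_space \<Rightarrow> 'b::euclidean_space) \<Rightarrow> 'a set"
  where "kernel A = {x. A x = 0}"

end

theory Submission
  imports Defs
begin

text \<open>The function \<open>F = h + g \<circ> S\<close> has at every point a first-order expansion that is uniform in the
  direction, with a directional derivative that is Lipschitz continuous in the direction and jointly
  upper semicontinuous, and composition with \<open>\<phi>\<close> preserves these properties. Hence limiting
  stationarity of \<open>F \<circ> \<phi>\<close> at \<open>y\<^sup>*\<close> means that the directional derivative of \<open>F\<close> at \<open>x\<^sup>*\<close> is nonnegative
  on the range of \<open>D\<phi>(y\<^sup>*)\<close>, and limiting stationarity of \<open>F + \<iota>\<^sub>C\<close> at \<open>x\<^sup>*\<close> means that it is nonnegative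
  on the tangent space \<open>T\<close> of \<open>C\<close>. The range is contained in \<open>T\<close>, which gives (a). The normal cone
  is orthogonal to \<open>T\<close>, so the kernel condition in (b) forces \<open>T\<close> to be contained in the range.\<close>

subsection \<open>Functions with an upper semicontinuous B-derivative\<close>

text \<open>The first clause is Bouligand differentiability; quantifying over all \<open>y\<close>
  near \<open>x\<close> makes the expansion uniform in the direction. Semicontinuity is required
  jointly in base point and direction, because limiting subgradients arise along sequences in which
  both vary.\<close>

definition has_usc_B_derivative ::
  "('a::euclidean_space \<Rightarrow> real) \<Rightarrow> ('a \<Rightarrow> 'a \<Rightarrow> real) \<Rightarrow> bool"
  where "has_usc_B_derivative J D \<longleftrightarrow>
    (\<forall>x. \<forall>e>0. \<forall>\<^sub>F y in nhds x. \<bar>J y - J x - D x (y - x)\<bar> \<le> e * norm (y - x)) \<and>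
    (\<forall>x. \<exists>L. L-lipschitz_on UNIV (D x)) \<and>
    (\<forall>x t u. 0 \<le> t \<longrightarrow> D x (t *\<^sub>R u) = t * D x u) \<and>
    (\<forall>x u. \<forall>e>0. \<forall>\<^sub>F p in nhds (x, u). D (fst p) (snd p) < D x u + e)"

lemma has_usc_B_derivativeI:
  assumes "\<And>x e. e > 0 \<Longrightarrow> \<forall>\<^sub>F y in nhds x. \<bar>J y - J x - D x (y - x)\<bar> \<le> e * norm (y - x)"
    and "\<And>x. \<exists>L. L-lipschitz_on UNIV (D x)"
    and "\<And>x t u. 0 \<le> t \<Longrightarrow> D x (t *\<^sub>R u) = t * D x u"
    and "\<And>x u e. e > 0 \<Longrightarrow> \<forall>\<^sub>F p in nhds (x, u). D (fst p) (snd p) < D x u + e"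
  shows "has_usc_B_derivative J D"
  using assms unfolding has_usc_B_derivative_def by blast

lemma has_usc_B_derivativeD:
  assumes "has_usc_B_derivative J D"
  shows "\<And>x e. e > 0 \<Longrightarrow> \<forall>\<^sub>F y in nhds x. \<bar>J y - J x - D x (y - x)\<bar> \<le> e * norm (y - x)"
    and "\<And>x. \<exists>L. L-lipschitz_on UNIV (D x)"
    and "\<And>x t u. 0 \<le> t \<Longrightarrow> D x (t *\<^sub>R u) = t * D x u"
    and "\<And>x u e. e > 0 \<Longrightarrow> \<forall>\<^sub>F p in nhds (x, u). D (fst p) (snd p) < D x u + e"
  using assms unfolding has_usc_B_derivative_def by blast+

section \<open>Sums, continuously differentiable functions and the chain rule\<close>

lemma has_derivative_eventually_le:
  assumes "(f has_derivative f') (at x)" and "e > 0"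
  shows "\<forall>\<^sub>F y in nhds x. norm (f y - f x - f' (y - x)) \<le> e * norm (y - x)"
  using assms unfolding has_derivative_at_alt eventually_nhds_metric dist_norm by blast

lemma has_usc_B_derivative_add:
  assumes "has_usc_B_derivative J D" and "has_usc_B_derivative K E"
  shows "has_usc_B_derivative (\<lambda>x. J x + K x) (\<lambda>x u. D x u + E x u)"
proof (rule has_usc_B_derivativeI)
  note J = has_usc_B_derivativeD[OF assms(1)] and K = has_usc_B_derivativeD[OF assms(2)]
  fix x u and e :: real assume "e > 0"
  then have e: "e / 2 > 0" by simp
  show "\<forall>\<^sub>F y in nhds x.
      \<bar>J y + K y - (J x + K x) - (D x (y - x) + E x (y - x))\<bar> \<le> e * norm (y - x)"
    using J(1)[OF e, of x] K(1)[OF e, of x] by eventually_elim argo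
  show "\<forall>\<^sub>F p in nhds (x, u). D (fst p) (snd p) + E (fst p) (snd p) < D x u + E x u + e"
    using J(4)[OF e, of x u] K(4)[OF e, of x u] by eventually_elim argo
next
  fix x
  obtain L M where "L-lipschitz_on UNIV (D x)" "M-lipschitz_on UNIV (E x)"
    using assms has_usc_B_derivativeD(2) by metis
  then show "\<exists>L. L-lipschitz_on UNIV (\<lambda>u. D x u + E x u)"
    by (blast intro: lipschitz_on_add)
next
  show "D x (t *\<^sub>R u) + E x (t *\<^sub>R u) = t * (D x u + E x u)" if "0 \<le> t" for x t u
    using has_usc_B_derivativeD(3)[OF assms(1) that] has_usc_B_derivativeD(3)[OF assms(2) that]
    by (simp add: algebra_simps)
qed

lemma isCont_imp_tendsto_nhds: "isCont f x \<Longrightarrow> (f \<longlongrightarrow> f x) (nhds x)"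
  by (simp add: isCont_def tendsto_at_iff_tendsto_nhds)

lemma lipschitz_on_blinfun: "(norm f)-lipschitz_on UNIV (blinfun_apply f)"
  by (rule lipschitz_onI) (auto simp: dist_norm norm_blinfun simp flip: blinfun.diff_right)

text \<open>Supplies the semicontinuity clause for continuously differentiable functions and the
  continuity of the inner map in the chain rule.\<close>

lemma tendsto_blinfun_apply_pair:
  fixes f' :: "'a::euclidean_space \<Rightarrow> 'b::euclidean_space \<Rightarrow>\<^sub>L 'c::euclidean_space"
  assumes "continuous_on UNIV f'"
  shows "((\<lambda>p. blinfun_apply (f' (fst p)) (snd p)) \<longlongrightarrow> blinfun_apply (f' x) u) (nhds (x, u))"
proof -
  have "isCont (\<lambda>p. blinfun_apply (f' (fst p)) (snd p)) (x, u)"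
    using assms
    by (intro continuous_intros continuous_at_compose[where g = f' and f = fst, unfolded o_def])
       (auto simp: continuous_on_eq_continuous_at)
  then show ?thesis
    by (auto dest: isCont_imp_tendsto_nhds)
qed

lemma has_usc_B_derivative_C1:
  assumes "\<And>x. (f has_derivative blinfun_apply (f' x)) (at x)" and "continuous_on UNIV f'"
  shows "has_usc_B_derivative f (\<lambda>x. blinfun_apply (f' x))"
proof (rule has_usc_B_derivativeI)
  fix x u and e :: real assume e: "e > 0"
  show "\<forall>\<^sub>F y in nhds x. \<bar>f y - f x - f' x (y - x)\<bar> \<le> e * norm (y - x)"
    using has_derivative_eventually_le[OF assms(1) e] by simp
  show "\<forall>\<^sub>F p in nhds (x, u). f' (fst p) (snd p) < f' x u + e"
    by (rule order_tendstoD(2)[OF tendsto_blinfun_apply_pair[OF assms(2)]]) (use e in simp)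
next
  fix x
  show "\<exists>L. L-lipschitz_on UNIV (f' x)" using lipschitz_on_blinfun by blast
qed (simp add: blinfun.scaleR_right)

text \<open>The error splits into the expansion error of \<open>J\<close> at \<open>f x\<close> and
  the remainder of \<open>f\<close>, which passes through the Lipschitz map \<open>D (f x)\<close>.
  Semicontinuity survives because \<open>(x, u)\<close> is sent continuously to
  \<open>(f x, f' x u)\<close>.\<close>

lemma has_usc_B_derivative_compose:
  fixes f :: "'b::euclidean_space \<Rightarrow> 'a::euclidean_space"
  assumes J: "has_usc_B_derivative J D"
    and f: "\<And>x. (f has_derivative blinfun_apply (f' x)) (at x)" and f': "continuous_on UNIV f'"
  shows "has_usc_B_derivative (\<lambda>x. J (f x)) (\<lambda>x u. D (f x) (f' x u))"
proof (rule has_usc_B_derivativeI)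
  fix x and e :: real assume e: "e > 0"
  obtain L where L: "L-lipschitz_on UNIV (D (f x))"
    using has_usc_B_derivativeD(2)[OF J] by blast
  \<comment> \<open>The added 1 makes \<open>K\<close> positive even if \<open>L = 0\<close>. With
    \<open>e2\<close> at most 1, the growth of \<open>f\<close> near \<open>x\<close> is bounded by
    \<open>M\<close>; then \<open>e1\<close> and \<open>e2\<close> make each of the two errors at
    most \<open>e / 2 * norm (y - x)\<close>.\<close>
  define K where "K = L + 1"
  have "L \<ge> 0" using L by (rule lipschitz_on_nonneg)
  then have "K > 0" by (simp add: K_def)
  define M where "M = norm (f' x) + 1"
  have "M > 0" unfolding M_def by (simp add: add_nonneg_pos)
  define e1 where "e1 = e / (2 * M)"
  define e2 where "e2 = min 1 (e / (2 * K))"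
  have "e1 > 0" "e2 > 0" using e \<open>K > 0\<close> \<open>M > 0\<close> by (auto simp: e1_def e2_def)
  have "isCont f x" using f has_derivative_continuous by blast
  then have lim: "filterlim f (nhds (f x)) (nhds x)"
    by (auto dest: isCont_imp_tendsto_nhds)
  have "\<forall>\<^sub>F y in nhds x. norm (J (f y) - J (f x) - D (f x) (f y - f x)) \<le> e1 * norm (f y - f x)"
    using eventually_compose_filterlim[OF has_usc_B_derivativeD(1)[OF J \<open>e1 > 0\<close>] lim] by simp
  with has_derivative_eventually_le[OF f \<open>e2 > 0\<close>, of x]
  show "\<forall>\<^sub>F y in nhds x. \<bar>J (f y) - J (f x) - D (f x) (f' x (y - x))\<bar> \<le> e * norm (y - x)"
  proof eventually_elim
    case (elim y)
    have "norm (f y - f x) \<le> norm (f' x (y - x)) + norm (f y - f x - f' x (y - x))"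
      using norm_triangle_sub by blast
    also have "\<dots> \<le> norm (f' x) * norm (y - x) + 1 * norm (y - x)"
      using elim(1) by (intro add_mono norm_blinfun order.trans[OF elim(1)] mult_right_mono)
        (auto simp: e2_def)
    also have "\<dots> = M * norm (y - x)" by (simp add: M_def algebra_simps)
    finally have "e1 * norm (f y - f x) \<le> e1 * (M * norm (y - x))"
      using \<open>e1 > 0\<close> by simp
    also have "\<dots> = e / 2 * norm (y - x)" using \<open>M > 0\<close> by (simp add: e1_def)
    finally have 1: "\<bar>J (f y) - J (f x) - D (f x) (f y - f x)\<bar> \<le> e / 2 * norm (y - x)"
      using elim(2) by simp
    have "\<bar>D (f x) (f y - f x) - D (f x) (f' x (y - x))\<bar> \<le> L * norm (f y - f x - f' x (y - x))"
      using lipschitz_onD[OF L] by (auto simp: dist_norm)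
    also have "\<dots> \<le> L * (e2 * norm (y - x))"
      using elim(1) \<open>L \<ge> 0\<close> by (intro mult_left_mono) auto
    also have "\<dots> \<le> K * (e / (2 * K) * norm (y - x))"
      using \<open>L \<ge> 0\<close> e by (intro mult_mono mult_right_mono) (auto simp: e2_def K_def)
    also have "\<dots> = e / 2 * norm (y - x)" using \<open>K > 0\<close> by simp
    finally show ?case using 1 by linarith
  qed
next
  fix x u :: 'b and e :: real assume e: "e > 0"
  have "isCont f x" using f has_derivative_continuous by blast
  then have "isCont (\<lambda>p. f (fst p)) (x, u)"
    by (intro continuous_at_compose[where g = f and f = fst, unfolded o_def]) auto
  then have "((\<lambda>p. f (fst p)) \<longlongrightarrow> f x) (nhds (x, u))"
    by (auto dest: isCont_imp_tendsto_nhds)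
  then have lim: "filterlim (\<lambda>p. (f (fst p), f' (fst p) (snd p))) (nhds (f x, f' x u)) (nhds (x, u))"
    by (intro tendsto_Pair tendsto_blinfun_apply_pair f')
  show "\<forall>\<^sub>F p in nhds (x, u). D (f (fst p)) (f' (fst p) (snd p)) < D (f x) (f' x u) + e"
    using eventually_compose_filterlim[OF has_usc_B_derivativeD(4)[OF J e] lim] by simp
next
  fix x
  obtain L where L: "L-lipschitz_on UNIV (D (f x))"
    using has_usc_B_derivativeD(2)[OF J] by blast
  from lipschitz_on_compose2[OF lipschitz_on_blinfun[of "f' x"], of L "D (f x)"] L
  show "\<exists>L. L-lipschitz_on UNIV (\<lambda>u. D (f x) (f' x u))"
    by (meson lipschitz_on_subset subset_UNIV)
qed (simp add: blinfun.scaleR_right has_usc_B_derivativeD(3)[OF J])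

subsection \<open>Weakly convex functions\<close>

definition difference_quotient :: "('a::real_vector \<Rightarrow> real) \<Rightarrow> 'a \<Rightarrow> 'a \<Rightarrow> real \<Rightarrow> real"
  where "difference_quotient G x u t = (G (x + t *\<^sub>R u) - G x) / t"

text \<open>For convex \<open>G\<close> the quotients decrease as \<open>t\<close> decreases to 0,
  so this infimum is the one-sided directional derivative. Written as an infimum of functions
  continuous in \<open>(x, u)\<close>, it is visibly upper semicontinuous.\<close>

definition convex_derivative :: "('a::real_vector \<Rightarrow> real) \<Rightarrow> 'a \<Rightarrow> 'a \<Rightarrow> real"
  where "convex_derivative G x u = (INF t\<in>{0<..}. difference_quotient G x u t)"

lemma difference_quotient_scaleR:
  "c \<noteq> 0 \<Longrightarrow> difference_quotient G x (c *\<^sub>R u) t = c * difference_quotient G x u (t * c)"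
  by (simp add: difference_quotient_def)

lemma continuous_on_difference_quotient:
  fixes G :: "'a::real_normed_vector \<Rightarrow> real"
  assumes "continuous_on UNIV G" and "continuous_on S f" and "continuous_on S g"
  shows "continuous_on S (\<lambda>p. difference_quotient G (f p) (g p) t)"
proof -
  have G: "continuous_on S (\<lambda>p. G (k p))" if "continuous_on S k" for k
    using continuous_on_compose2[OF assms(1) that] by simp
  show ?thesis
    unfolding difference_quotient_def divide_inverse
    by (intro continuous_intros G assms)
qed

section \<open>Directional derivatives of convex functions\<close>

context
  fixes G :: "'a::euclidean_space \<Rightarrow> real"
  assumes convex: "convex_on UNIV G"
begin

text \<open>The point \<open>x + s u\<close> is the convex combination of \<open>x\<close> and
  \<open>x + t u\<close> with weight \<open>s / t\<close> on the latter.\<close>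

lemma difference_quotient_mono:
  assumes "0 < s" and "s \<le> t"
  shows "difference_quotient G x u s \<le> difference_quotient G x u t"
proof -
  have "G ((1 - s / t) *\<^sub>R x + (s / t) *\<^sub>R (x + t *\<^sub>R u)) \<le> (1 - s / t) * G x + (s / t) * G (x + t *\<^sub>R u)"
    using assms by (intro convex_onD[OF convex]) auto
  also have "(1 - s / t) *\<^sub>R x + (s / t) *\<^sub>R (x + t *\<^sub>R u) = x + s *\<^sub>R u"
    using assms by (simp add: algebra_simps)
  finally have "G (x + s *\<^sub>R u) - G x \<le> s * difference_quotient G x u t"
    by (simp add: difference_quotient_def algebra_simps diff_divide_distrib)
  then show ?thesis
    using assms by (simp add: difference_quotient_def[of G x u s] divide_le_eq mult.commute)
qed

text \<open>The point \<open>x\<close> lies between \<open>x - u\<close> and \<open>x + t u\<close>.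
  The resulting bound does not depend on \<open>t\<close>, so the infimum defining the derivative is
  taken over a set bounded below.\<close>

lemma difference_quotient_lower_bound:
  assumes "t > 0"
  shows "G x - G (x - u) \<le> difference_quotient G x u t"
proof -
  \<comment> \<open>This weight solves \<open>(1 - c) * t = c\<close>, so the combination of
    \<open>x + t u\<close> and \<open>x - u\<close> below is \<open>x\<close> itself.\<close>
  define c where "c = t / (1 + t)"
  have c: "0 \<le> c" "c \<le> 1" "1 - c = 1 / (1 + t)" using assms by (auto simp: c_def field_simps)
  have "G ((1 - c) *\<^sub>R (x + t *\<^sub>R u) + c *\<^sub>R (x - u)) \<le> (1 - c) * G (x + t *\<^sub>R u) + c * G (x - u)"
    using c by (intro convex_onD[OF convex]) auto
  also have "(1 - c) *\<^sub>R (x + t *\<^sub>R u) + c *\<^sub>R (x - u) = x + ((1 - c) * t - c) *\<^sub>R u"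
    by (simp add: algebra_simps)
  also have "(1 - c) * t - c = 0" using c(3) by (simp add: c_def)
  finally have "G x \<le> G (x + t *\<^sub>R u) / (1 + t) + t * G (x - u) / (1 + t)"
    unfolding c(3) by (simp add: c_def)
  then have "(1 + t) * G x \<le> G (x + t *\<^sub>R u) + t * G (x - u)"
    using assms by (simp add: pos_le_divide_eq mult.commute flip: add_divide_distrib)
  then show ?thesis
    using assms by (simp add: difference_quotient_def le_divide_eq algebra_simps)
qed

lemma convex_derivative_le_quotient:
  "t > 0 \<Longrightarrow> convex_derivative G x u \<le> difference_quotient G x u t"
  unfolding convex_derivative_def
  by (rule cINF_lower) (auto intro!: bdd_belowI2 difference_quotient_lower_bound)

lemma convex_derivative_greatest:
  "(\<And>t. t > 0 \<Longrightarrow> c \<le> difference_quotient G x u t) \<Longrightarrow> c \<le> convex_derivative G x u"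
  unfolding convex_derivative_def by (rule cINF_greatest) auto

lemma convex_derivative_approx:
  assumes "e > 0"
  obtains t where "t > 0" and "difference_quotient G x u t < convex_derivative G x u + e"
  using convex_derivative_greatest[of "convex_derivative G x u + e" x u] assms by force

lemma convex_derivative_zero: "convex_derivative G x 0 = 0"
  by (simp add: convex_derivative_def difference_quotient_def)

text \<open>Rescaling the step to \<open>t / b\<close> gives one inequality for every positive
  factor \<open>b\<close>; applying it to \<open>1 / c\<close> as well gives the reverse
  one.\<close>

lemma convex_derivative_scaleR:
  assumes "0 \<le> c"
  shows "convex_derivative G x (c *\<^sub>R u) = c * convex_derivative G x u"
proof (cases "c = 0")
  case False
  with assms have c: "c > 0" by simp
  have ge: "convex_derivative G x (b *\<^sub>R v) \<le> b * convex_derivative G x v" if "b > 0" for b v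
  proof -
    have "convex_derivative G x (b *\<^sub>R v) / b \<le> convex_derivative G x v"
    proof (rule convex_derivative_greatest)
      fix t :: real assume "t > 0"
      then have "convex_derivative G x (b *\<^sub>R v) \<le> difference_quotient G x (b *\<^sub>R v) (t / b)"
        using that by (intro convex_derivative_le_quotient) simp
      then show "convex_derivative G x (b *\<^sub>R v) / b \<le> difference_quotient G x v t"
        using that by (simp add: difference_quotient_scaleR divide_le_eq mult.commute)
    qed
    then show ?thesis using that by (simp add: divide_le_eq mult.commute)
  qed
  have "convex_derivative G x u \<le> (1 / c) * convex_derivative G x (c *\<^sub>R u)"
    using ge[of "1 / c" "c *\<^sub>R u"] c by simp
  then show ?thesis using ge[OF c, of u] c by (simp add: field_simps)
qed (simp add: convex_derivative_zero)

text \<open>Midpoint convexity: \<open>x + t (u + v)\<close> is the midpoint of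
  \<open>x + 2 t u\<close> and \<open>x + 2 t v\<close>.\<close>

lemma convex_derivative_subadditive:
  "convex_derivative G x (u + v) \<le> convex_derivative G x u + convex_derivative G x v"
proof (rule field_le_epsilon)
  fix e :: real assume "e > 0"
  then have "e / 2 > 0" by simp
  obtain s where s: "s > 0" "difference_quotient G x u s < convex_derivative G x u + e / 2"
    using convex_derivative_approx[OF \<open>e / 2 > 0\<close>] by blast
  obtain r where r: "r > 0" "difference_quotient G x v r < convex_derivative G x v + e / 2"
    using convex_derivative_approx[OF \<open>e / 2 > 0\<close>] by blast
  \<comment> \<open>Halving leaves the doubled step \<open>2 * t\<close> below both \<open>s\<close>
    and \<open>r\<close>, so monotonicity bounds the quotients by the two near-optimal ones.\<close>
  define t where "t = min s r / 2"
  have t: "t > 0" "2 * t \<le> s" "2 * t \<le> r" using s(1) r(1) by (auto simp: t_def)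
  have "G ((1 - 1/2) *\<^sub>R (x + (2 * t) *\<^sub>R u) + (1/2) *\<^sub>R (x + (2 * t) *\<^sub>R v))
      \<le> (1 - 1/2) * G (x + (2 * t) *\<^sub>R u) + (1/2) * G (x + (2 * t) *\<^sub>R v)"
    by (intro convex_onD[OF convex]) auto
  also have "(1 - 1/2) *\<^sub>R (x + (2 * t) *\<^sub>R u) + (1/2) *\<^sub>R (x + (2 * t) *\<^sub>R v) = x + t *\<^sub>R (u + v)"
    by (simp add: algebra_simps flip: scaleR_left_distrib)
  finally have "difference_quotient G x (u + v) t
      \<le> ((G (x + (2 * t) *\<^sub>R u) + G (x + (2 * t) *\<^sub>R v)) / 2 - G x) / t"
    unfolding difference_quotient_def using t(1) by (intro divide_right_mono) auto
  also have "\<dots> = difference_quotient G x u (2 * t) + difference_quotient G x v (2 * t)"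
    using t(1) by (simp add: difference_quotient_def field_simps)
  also have "\<dots> \<le> difference_quotient G x u s + difference_quotient G x v r"
    using t by (intro add_mono difference_quotient_mono) auto
  finally show "convex_derivative G x (u + v)
      \<le> convex_derivative G x u + convex_derivative G x v + e"
    using convex_derivative_le_quotient[OF t(1), of x "u + v"] s(2) r(2) by linarith
qed

lemma continuous_on_convex: "continuous_on S G"
  using convex_on_continuous[OF open_UNIV convex] continuous_on_subset by blast

text \<open>The quotient with step 1 dominates the derivative and is bounded on the compact unit
  sphere, so homogeneity gives a bound linear in \<open>norm u\<close>. Subadditivity turns this
  bound into a Lipschitz estimate.\<close>

lemma convex_derivative_lipschitz: "\<exists>L. L-lipschitz_on UNIV (convex_derivative G x)"
proof -
  have "compact ((\<lambda>u. difference_quotient G x u 1) ` sphere 0 1)"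
    by (intro compact_continuous_image continuous_on_difference_quotient continuous_on_convex
        continuous_intros compact_sphere)
  then have "bounded ((\<lambda>u. difference_quotient G x u 1) ` sphere 0 1)"
    by (rule compact_imp_bounded)
  then obtain M where M: "M > 0"
      "\<And>u. u \<in> sphere 0 1 \<Longrightarrow> norm (difference_quotient G x u 1) \<le> M"
    unfolding bounded_pos by blast
  have le: "convex_derivative G x u \<le> M * norm u" for u
  proof (cases "u = 0")
    case False
    define b where "b = u /\<^sub>R norm u"
    have "b \<in> sphere 0 1" using False by (simp add: b_def)
    then have "convex_derivative G x b \<le> M"
      using M(2)[of b] convex_derivative_le_quotient[of 1 x b] by force
    moreover have "convex_derivative G x u = norm u * convex_derivative G x b"
      using False by (simp add: b_def flip: convex_derivative_scaleR)
    ultimately show ?thesis by (metis mult.commute mult_left_mono norm_ge_zero)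
  qed (simp add: convex_derivative_zero)
  have diff: "convex_derivative G x u - convex_derivative G x v \<le> M * norm (u - v)" for u v
    using convex_derivative_subadditive[of x "u - v" v] le[of "u - v"] by simp
  have "M-lipschitz_on UNIV (convex_derivative G x)"
  proof (rule lipschitz_onI)
    show "dist (convex_derivative G x u) (convex_derivative G x v) \<le> M * dist u v" for u v
      using diff[of u v] diff[of v u] by (auto simp: dist_norm norm_minus_commute abs_le_iff)
  qed (use M in simp)
  then show ?thesis by blast
qed

text \<open>The expansion is uniform in the direction by the argument of Dini's theorem: the quotients
  decrease to a continuous limit as \<open>t\<close> decreases to \<open>0\<close>, and the unit sphere is compact.\<close>

lemma convex_derivative_uniform:
  assumes e: "e > 0"
  shows "\<exists>r>0. \<forall>t u. 0 < t \<longrightarrow> t \<le> r \<longrightarrow> norm u = 1 \<longrightarrow>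
    difference_quotient G x u t < convex_derivative G x u + e"
proof -
  define N where "N t = {u. difference_quotient G x u t < convex_derivative G x u + e}" for t
  have cont: "continuous_on UNIV (convex_derivative G x)"
    using convex_derivative_lipschitz lipschitz_on_continuous_on by blast
  have op: "open (N t)" for t
    unfolding N_def
    by (intro open_Collect_less continuous_intros cont continuous_on_difference_quotient
        continuous_on_convex)
  have cover: "sphere 0 1 \<subseteq> (\<Union>t\<in>{0<..}. N t)"
    using convex_derivative_approx[OF e] unfolding N_def by blast
  obtain T where T: "T \<subseteq> {0<..}" "finite T" "sphere 0 1 \<subseteq> (\<Union>t\<in>T. N t)"
    by (rule compactE_image[OF compact_sphere[of "0::'a" 1] op cover])
  \<comment> \<open>The element 1 only guarantees that the minimum is over a nonempty set. Every
    step up to \<open>r\<close> is below every step of the finite cover, so monotonicity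
    applies.\<close>
  define r where "r = Min (insert 1 T)"
  have "r > 0" using T by (auto simp: r_def)
  moreover have "difference_quotient G x u t < convex_derivative G x u + e"
    if tu: "0 < t" "t \<le> r" "norm u = 1" for t u
  proof -
    obtain s where s: "s \<in> T" "u \<in> N s" using T(3) tu(3) by force
    then have "t \<le> s" using tu(2) T(2) by (simp add: r_def)
    from difference_quotient_mono[OF tu(1) this, of x u] show ?thesis
      using s(2) by (simp add: N_def)
  qed
  ultimately show ?thesis by blast
qed

text \<open>The lower half of the expansion is the infimum property at step 1, the upper half is the
  uniform estimate on unit directions, scaled by \<open>norm (y - x)\<close>.\<close>

lemma convex_on_has_usc_B_derivative: "has_usc_B_derivative G (convex_derivative G)"
proof (rule has_usc_B_derivativeI)
  fix x and e :: real assume e: "e > 0"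
  obtain r where r: "r > 0" "\<And>t u. 0 < t \<Longrightarrow> t \<le> r \<Longrightarrow> norm u = 1 \<Longrightarrow>
    difference_quotient G x u t < convex_derivative G x u + e"
    using convex_derivative_uniform[OF e] by blast
  have "\<bar>G y - G x - convex_derivative G x (y - x)\<bar> \<le> e * norm (y - x)" if "dist y x < r" for y
  proof (cases "y = x")
    case False
    define t where "t = norm (y - x)"
    define u where "u = (y - x) /\<^sub>R t"
    have t: "t > 0" "t \<le> r" using that False by (auto simp: t_def dist_norm)
    have u: "norm u = 1" using False by (simp add: u_def t_def)
    have y: "y - x = t *\<^sub>R u" using t(1) by (simp add: u_def)
    have "G y - G x = t * difference_quotient G x u t"
      using t(1) by (simp add: difference_quotient_def flip: y)
    then have "G y - G x \<le> t * (convex_derivative G x u + e)"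
      using r(2)[OF t u] t(1) by simp
    moreover have "G y - G x \<ge> convex_derivative G x (y - x)"
      using convex_derivative_le_quotient[of 1 x "y - x"] by (simp add: difference_quotient_def)
    moreover have "convex_derivative G x (y - x) = t * convex_derivative G x u"
      using t(1) by (simp add: y convex_derivative_scaleR)
    ultimately show ?thesis by (simp add: t_def algebra_simps)
  qed (simp add: convex_derivative_zero)
  then show "\<forall>\<^sub>F y in nhds x. \<bar>G y - G x - convex_derivative G x (y - x)\<bar> \<le> e * norm (y - x)"
    unfolding eventually_nhds_metric using r(1) by blast
next
  fix x u and e :: real assume e: "e > 0"
  \<comment> \<open>One near-optimal step is frozen: its quotient is continuous in the pair of point
    and direction and dominates the derivative at every pair.\<close>
  obtain t where t: "t > 0" "difference_quotient G x u t < convex_derivative G x u + e"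
    using convex_derivative_approx[OF e] by blast
  have "continuous_on UNIV (\<lambda>p. difference_quotient G (fst p) (snd p) t)"
    by (intro continuous_on_difference_quotient continuous_on_convex continuous_intros)
  then have "isCont (\<lambda>p. difference_quotient G (fst p) (snd p) t) (x, u)"
    by (simp add: continuous_on_eq_continuous_at)
  then have "\<forall>\<^sub>F p in nhds (x, u). difference_quotient G (fst p) (snd p) t < convex_derivative G x u + e"
    using t(2) by (auto dest!: isCont_imp_tendsto_nhds intro: order_tendstoD)
  then show "\<forall>\<^sub>F p in nhds (x, u). convex_derivative G (fst p) (snd p) < convex_derivative G x u + e"
    by eventually_elim (use convex_derivative_le_quotient[OF t(1)] order.strict_trans1 in blast)
qed (auto simp: convex_derivative_lipschitz convex_derivative_scaleR)

end

text \<open>\<open>g\<close> is the sum of a convex function and the smooth function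
  \<open>- (\<eta> / 2) * (norm z)\<^sup>2\<close>, whose gradient is
  \<open>- \<eta> *\<^sub>R z\<close>.\<close>

lemma weakly_convex_has_usc_B_derivative:
  assumes "weakly_convex \<eta> g"
  obtains D where "has_usc_B_derivative g D"
proof -
  define f' :: "'a \<Rightarrow> 'a \<Rightarrow>\<^sub>L real" where "f' z = blinfun_inner_left (- \<eta> *\<^sub>R z)" for z
  have "((\<lambda>z. - (\<eta> / 2) * (norm z)\<^sup>2) has_derivative blinfun_apply (f' z)) (at z)" for z
    unfolding power2_norm_eq_inner f'_def
    by (auto intro!: derivative_eq_intros simp: inner_commute)
  moreover have "continuous_on UNIV f'"
    unfolding f'_def by (intro continuous_intros)
  ultimately have "has_usc_B_derivative (\<lambda>z. - (\<eta> / 2) * (norm z)\<^sup>2) (\<lambda>z. blinfun_apply (f' z))"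
    by (rule has_usc_B_derivative_C1)
  from has_usc_B_derivative_add[OF convex_on_has_usc_B_derivative this]
  show thesis
    using assms that unfolding weakly_convex_def by fastforce
qed

subsection \<open>Constrained subdifferentials and tangent spaces\<close>

text \<open>Turns the extended-real lower limit into a real inequality. Off \<open>C\<close> the
  quotient is infinite and imposes nothing; at \<open>y = x\<close> both sides vanish, so the
  punctured filter may be replaced by the full one.\<close>

lemma frechet_subdifferential_constrained_iff:
  fixes J :: "'a::euclidean_space \<Rightarrow> real"
  shows "v \<in> frechet_subdifferential (\<lambda>x. ereal (J x) + set_indicator C x) x \<longleftrightarrow>
    x \<in> C \<and> (\<forall>e>0. \<forall>\<^sub>F y in nhds x. y \<in> C \<longrightarrow> - (e * norm (y - x)) \<le> J y - J x - v \<bullet> (y - x))"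
proof (cases "x \<in> C")
  case True
  define Q where "Q y = (ereal (J y) + set_indicator C y - (ereal (J x) + set_indicator C x)
    - ereal (v \<bullet> (y - x))) / ereal (norm (y - x))" for y
  have Q: "Q y = (if y \<in> C then ereal ((J y - J x - v \<bullet> (y - x)) / norm (y - x)) else \<infinity>)"
    if "y \<noteq> x" for y
    using that True by (auto simp: Q_def set_indicator_def)
  have "0 \<le> Liminf (at x) Q \<longleftrightarrow>
      (\<forall>e>0. \<forall>\<^sub>F y in nhds x. y \<in> C \<longrightarrow> - (e * norm (y - x)) \<le> J y - J x - v \<bullet> (y - x))"
    (is "_ \<longleftrightarrow> ?R")
  proof
    assume L: "0 \<le> Liminf (at x) Q"
    show ?R
    proof (intro allI impI)
      fix e :: real assume "e > 0"
      then have "\<forall>\<^sub>F y in at x. ereal (- e) < Q y"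
        using L by (simp add: le_Liminf_iff)
      then show "\<forall>\<^sub>F y in nhds x. y \<in> C \<longrightarrow> - (e * norm (y - x)) \<le> J y - J x - v \<bullet> (y - x)"
        unfolding eventually_at_filter
      proof eventually_elim
        case (elim y)
        show ?case
          using elim by (cases "y = x") (auto simp: Q less_divide_eq)
      qed
    qed
  next
    assume R: ?R
    show "0 \<le> Liminf (at x) Q"
      unfolding le_Liminf_iff
    proof (intro allI impI)
      fix c :: ereal assume "c < 0"
      \<comment> \<open>The bound \<open>c\<close> may be minus infinity, so a real number between
        \<open>c\<close> and 0 provides the tolerance \<open>- r\<close>.\<close>
      then obtain r where r: "c < ereal r" "r < 0"
        by (metis ereal_dense2 ereal_less(2) less_ereal.simps(1) zero_ereal_def)
      then have "- r > 0" by simp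
      then have "\<forall>\<^sub>F y in nhds x. y \<in> C \<longrightarrow> - (- r * norm (y - x)) \<le> J y - J x - v \<bullet> (y - x)"
        using R by blast
      then show "\<forall>\<^sub>F y in at x. c < Q y"
        unfolding eventually_at_filter
      proof eventually_elim
        case (elim y)
        show ?case
        proof (intro impI)
          assume "y \<noteq> x"
          then have "y \<in> C \<Longrightarrow> r \<le> (J y - J x - v \<bullet> (y - x)) / norm (y - x)"
            using elim by (simp add: le_divide_eq)
          then show "c < Q y"
            using r(1) \<open>y \<noteq> x\<close> by (auto simp: Q intro: less_le_trans)
        qed
      qed
    qed
  qed
  then show ?thesis
    using True unfolding frechet_subdifferential_def Q_def by (simp add: set_indicator_def)
qed (simp add: frechet_subdifferential_def set_indicator_def)

text \<open>Constant sequences are admissible in the limiting subdifferential.\<close>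

lemma frechet_subset_limiting_subdifferential:
  "frechet_subdifferential J x \<subseteq> limiting_subdifferential J x"
proof
  fix v assume v: "v \<in> frechet_subdifferential J x"
  then have "J x < \<infinity>" by (simp add: frechet_subdifferential_def)
  with v show "v \<in> limiting_subdifferential J x"
    unfolding limiting_subdifferential_def
    by (intro CollectI conjI exI[of _ "\<lambda>_. x"] exI[of _ "\<lambda>_. v"]) simp_all
qed

text \<open>The second clause makes \<open>T\<close> part of the regular (Clarke) tangent cone of \<open>C\<close> at \<open>p\<close>, the third
  one makes it contain the Bouligand tangent cone.\<close>

definition tangent_space_at :: "'a::euclidean_space set \<Rightarrow> 'a \<Rightarrow> 'a set \<Rightarrow> bool"
  where "tangent_space_at C p T \<longleftrightarrow> subspace T \<and>
    (\<forall>u\<in>T. \<forall>xs. (\<forall>n. xs n \<in> C) \<longrightarrow> xs \<longlonglongrightarrow> p \<longrightarrow>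
      (\<exists>us. us \<longlonglongrightarrow> u \<and> (\<forall>\<^sub>F n in sequentially. \<exists>\<gamma>. \<gamma> 0 = xs n \<and>
        (\<gamma> has_vector_derivative us n) (at 0) \<and> (\<forall>\<^sub>F t in at_right 0. \<gamma> t \<in> C)))) \<and>
    (\<forall>e>0. \<forall>\<^sub>F y in nhds p. y \<in> C \<longrightarrow> (\<exists>u\<in>T. norm (y - p - u) \<le> e * norm (y - p)))"

text \<open>Straight lines serve as the curves. This case lets an unconstrained function be treated
  as one constrained to the whole space.\<close>

lemma tangent_space_at_UNIV: "tangent_space_at UNIV p UNIV"
  unfolding tangent_space_at_def
proof (intro conjI ballI allI impI)
  fix u p :: 'a and xs :: "nat \<Rightarrow> 'a"
  have "\<exists>\<gamma>. \<gamma> 0 = x \<and> (\<gamma> has_vector_derivative u) (at 0) \<and>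
      (\<forall>\<^sub>F t in at_right 0. \<gamma> t \<in> UNIV)" for x :: 'a
    by (rule exI[of _ "\<lambda>t. x + t *\<^sub>R u"]) (auto intro!: derivative_eq_intros)
  then show "\<exists>us. us \<longlonglongrightarrow> u \<and> (\<forall>\<^sub>F n in sequentially. \<exists>\<gamma>. \<gamma> 0 = xs n \<and>
      (\<gamma> has_vector_derivative us n) (at 0) \<and> (\<forall>\<^sub>F t in at_right 0. \<gamma> t \<in> UNIV))"
    by (intro exI[of _ "\<lambda>_. u"]) simp
next
  fix p :: 'a and e :: real assume "e > 0"
  then have "\<exists>u\<in>UNIV. norm (y - p - u) \<le> e * norm (y - p)" for y
    by (intro bexI[of _ "y - p"]) auto
  then show "\<forall>\<^sub>F y in nhds p. y \<in> UNIV \<longrightarrow> (\<exists>u\<in>UNIV. norm (y - p - u) \<le> e * norm (y - p))"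
    by simp
qed simp

section \<open>Subgradient inequalities and tangent directions\<close>

lemma le_if_le_add_small_multiple:
  fixes a b c :: real
  assumes "\<And>e. e > 0 \<Longrightarrow> a \<le> b + e * c"
  shows "a \<le> b"
proof (rule field_le_epsilon)
  fix e :: real assume "e > 0"
  then have "a \<le> b + e / (\<bar>c\<bar> + 1) * c"
    by (intro assms) simp
  also have "\<dots> \<le> b + e / (\<bar>c\<bar> + 1) * (\<bar>c\<bar> + 1)"
    using \<open>e > 0\<close> by (intro add_left_mono mult_left_mono) auto
  also have "\<dots> = b + e" by simp
  finally show "a \<le> b + e" .
qed

lemma has_vector_derivative_at_right_quotient:
  fixes \<gamma> :: "real \<Rightarrow> 'a::real_normed_vector"
  assumes "(\<gamma> has_vector_derivative u) (at 0)"
  shows "((\<lambda>t. (\<gamma> t - \<gamma> 0) /\<^sub>R t) \<longlongrightarrow> u) (at_right 0)"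
proof -
  have "((\<lambda>t. (\<gamma> t - \<gamma> 0) /\<^sub>R t - u) \<longlongrightarrow> 0) (at_right 0)"
  proof (rule tendsto_norm_zero_cancel)
    have "((\<lambda>t. norm (\<gamma> t - \<gamma> 0 - t *\<^sub>R u) / \<bar>t\<bar>) \<longlongrightarrow> 0) (at_right 0)"
      using has_vector_derivative_at_within[OF assms, of "{0<..}"]
      by (simp add: has_vector_derivative_def has_derivative_iff_norm)
    moreover have "\<forall>\<^sub>F t in at_right 0. norm (\<gamma> t - \<gamma> 0 - t *\<^sub>R u) / \<bar>t\<bar>
        = norm ((\<gamma> t - \<gamma> 0) /\<^sub>R t - u)"
      using eventually_at_right_less
    proof eventually_elim
      case (elim t)
      have "(\<gamma> t - \<gamma> 0) /\<^sub>R t - u = (\<gamma> t - \<gamma> 0 - t *\<^sub>R u) /\<^sub>R t"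
        using elim by (simp add: algebra_simps)
      then show ?case by (simp add: divide_inverse)
    qed
    ultimately show "((\<lambda>t. norm ((\<gamma> t - \<gamma> 0) /\<^sub>R t - u)) \<longlongrightarrow> 0) (at_right 0)"
      by (rule Lim_transform_eventually)
  qed
  then show ?thesis using LIM_zero_iff by blast
qed

lemma has_vector_derivative_along_line:
  assumes "(f has_derivative f') (at x)"
  shows "((\<lambda>t. f (x + t *\<^sub>R w)) has_vector_derivative f' w) (at 0)"
proof -
  have f: "(f has_derivative f') (at (x + 0 *\<^sub>R w))" using assms by simp
  have "((\<lambda>t. x + t *\<^sub>R w) has_derivative (\<lambda>t. t *\<^sub>R w)) (at 0)"
    by (auto intro!: derivative_eq_intros)
  from diff_chain_at[OF this f] show ?thesis
    by (simp add: has_vector_derivative_def o_def linear_cmul[OF has_derivative_linear[OF assms]])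
qed

text \<open>Along the curve, the subgradient inequality and the expansion of \<open>J\<close> are
  divided by \<open>t\<close>, using positive homogeneity; then \<open>t\<close> tends to 0, and the
  tolerance \<open>e\<close> is arbitrary.\<close>

lemma frechet_subgradient_le_along_curve:
  assumes J: "has_usc_B_derivative J D"
    and v: "v \<in> frechet_subdifferential (\<lambda>x. ereal (J x) + set_indicator C x) (\<gamma> 0)"
    and \<gamma>: "(\<gamma> has_vector_derivative u) (at 0)" and C: "\<forall>\<^sub>F t in at_right 0. \<gamma> t \<in> C"
  shows "v \<bullet> u \<le> D (\<gamma> 0) u"
proof (rule le_if_le_add_small_multiple)
  fix e :: real assume e: "e > 0"
  define q where "q t = (\<gamma> t - \<gamma> 0) /\<^sub>R t" for t
  have q: "(q \<longlongrightarrow> u) (at_right 0)"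
    unfolding q_def by (rule has_vector_derivative_at_right_quotient[OF \<gamma>])
  obtain L where "L-lipschitz_on UNIV (D (\<gamma> 0))"
    using has_usc_B_derivativeD(2)[OF J] by blast
  then have "isCont (D (\<gamma> 0)) u"
    using lipschitz_on_continuous_on continuous_on_eq_continuous_at[OF open_UNIV] by blast
  then have Dq: "((\<lambda>t. D (\<gamma> 0) (q t)) \<longlongrightarrow> D (\<gamma> 0) u) (at_right 0)"
    using q by (rule isCont_tendsto_compose)
  have "(\<gamma> \<longlongrightarrow> \<gamma> 0) (at_right 0)"
    using has_vector_derivative_continuous[OF \<gamma>] by (auto simp: isCont_def intro: tendsto_within_subset)
  then have lim: "filterlim \<gamma> (nhds (\<gamma> 0)) (at_right 0)" .
  have "\<forall>\<^sub>F y in nhds (\<gamma> 0). y \<in> C \<longrightarrow>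
      - (e * norm (y - \<gamma> 0)) \<le> J y - J (\<gamma> 0) - v \<bullet> (y - \<gamma> 0)"
    using v e by (simp add: frechet_subdifferential_constrained_iff)
  note 1 = eventually_compose_filterlim[OF this lim]
    eventually_compose_filterlim[OF has_usc_B_derivativeD(1)[OF J e, of "\<gamma> 0"] lim]
  \<comment> \<open>The factor 2 counts the error of the subgradient inequality and that of the
    expansion.\<close>
  have "\<forall>\<^sub>F t in at_right 0. v \<bullet> q t \<le> D (\<gamma> 0) (q t) + e * (2 * norm (q t))"
    using 1 C eventually_at_right_less
  proof eventually_elim
    case (elim t)
    have \<gamma>: "\<gamma> t - \<gamma> 0 = t *\<^sub>R q t" using elim(4) by (simp add: q_def)
    have "v \<bullet> (\<gamma> t - \<gamma> 0) \<le> D (\<gamma> 0) (\<gamma> t - \<gamma> 0) + e * (2 * norm (\<gamma> t - \<gamma> 0))"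
      using elim(1,2,3) by auto
    then have "t * (v \<bullet> q t) \<le> t * (D (\<gamma> 0) (q t) + e * (2 * norm (q t)))"
      unfolding \<gamma> using elim(4)
      by (simp add: has_usc_B_derivativeD(3)[OF J] algebra_simps)
    then show ?case using elim(4) by simp
  qed
  then show "v \<bullet> u \<le> D (\<gamma> 0) u + e * (2 * norm u)"
    by (rule tendsto_le[OF trivial_limit_at_right_real _ _, rotated 2])
       (intro tendsto_intros q Dq)+
qed

text \<open>The inequality along curves holds at each approximating point \<open>xs n\<close> with a
  direction \<open>us n\<close> tending to \<open>u\<close>. Joint upper semicontinuity of
  \<open>D\<close> carries it to the limit.\<close>

lemma limiting_subgradient_le:
  assumes J: "has_usc_B_derivative J D" and T: "tangent_space_at C p T"
    and v: "v \<in> limiting_subdifferential (\<lambda>x. ereal (J x) + set_indicator C x) p"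
    and u: "u \<in> T"
  shows "v \<bullet> u \<le> D p u"
proof (rule field_le_epsilon)
  fix e :: real assume e: "e > 0"
  obtain xs vs where xs: "xs \<longlonglongrightarrow> p" and vs: "vs \<longlonglongrightarrow> v"
    and sub: "\<And>n. vs n \<in> frechet_subdifferential (\<lambda>x. ereal (J x) + set_indicator C x) (xs n)"
    using v unfolding limiting_subdifferential_def by blast
  have "xs n \<in> C" for n
    using sub[of n] by (simp add: frechet_subdifferential_constrained_iff)
  then obtain us where us: "us \<longlonglongrightarrow> u"
    and curve: "\<forall>\<^sub>F n in sequentially. \<exists>\<gamma>. \<gamma> 0 = xs n \<and>
        (\<gamma> has_vector_derivative us n) (at 0) \<and> (\<forall>\<^sub>F t in at_right 0. \<gamma> t \<in> C)"
    using T u xs unfolding tangent_space_at_def by blast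
  have "filterlim (\<lambda>n. (xs n, us n)) (nhds (p, u)) sequentially"
    by (intro tendsto_Pair xs us)
  from eventually_compose_filterlim[OF has_usc_B_derivativeD(4)[OF J e, of p u] this] curve
  have "\<forall>\<^sub>F n in sequentially. vs n \<bullet> us n \<le> D p u + e"
  proof eventually_elim
    case (elim n)
    obtain \<gamma> where "\<gamma> 0 = xs n" "(\<gamma> has_vector_derivative us n) (at 0)"
      "\<forall>\<^sub>F t in at_right 0. \<gamma> t \<in> C"
      using elim(2) by blast
    then show ?case
      using frechet_subgradient_le_along_curve[OF J, of "vs n" C \<gamma> "us n"] sub[of n] elim(1) by simp
  qed
  then show "v \<bullet> u \<le> D p u + e"
    by (intro tendsto_upperbound[OF tendsto_inner[OF vs us]]) auto
qed

text \<open>A point of \<open>C\<close> near \<open>p\<close> differs from \<open>p\<close> by a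
  vector of \<open>T\<close> up to a small relative error, and both \<open>D p\<close> and the inner
  product with \<open>v\<close> are Lipschitz. Hence the inequality on \<open>T\<close>
  suffices.\<close>

lemma frechet_subdifferentialI:
  assumes J: "has_usc_B_derivative J D" and T: "tangent_space_at C p T" and "p \<in> C"
    and le: "\<And>u. u \<in> T \<Longrightarrow> v \<bullet> u \<le> D p u"
  shows "v \<in> frechet_subdifferential (\<lambda>x. ereal (J x) + set_indicator C x) p"
  unfolding frechet_subdifferential_constrained_iff
proof (intro conjI allI impI)
  fix e :: real assume e: "e > 0"
  obtain L where L: "L-lipschitz_on UNIV (D p)"
    using has_usc_B_derivativeD(2)[OF J] by blast
  then have "L \<ge> 0" by (rule lipschitz_on_nonneg)
  \<comment> \<open>The summands count, in multiples of \<open>c * norm (y - p)\<close>, the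
    expansion error of \<open>J\<close>, the change in \<open>D p\<close> and the change in the
    inner product with \<open>v\<close>.\<close>
  define K where "K = 1 + L + norm v"
  have K: "K > 0" using \<open>L \<ge> 0\<close> by (simp add: K_def add_pos_nonneg)
  define c where "c = e / K"
  have c: "c > 0" using e K by (simp add: c_def)
  have "\<forall>\<^sub>F y in nhds p. y \<in> C \<longrightarrow> (\<exists>u\<in>T. norm (y - p - u) \<le> c * norm (y - p))"
    using T c unfolding tangent_space_at_def by blast
  with has_usc_B_derivativeD(1)[OF J c, of p]
  show "\<forall>\<^sub>F y in nhds p. y \<in> C \<longrightarrow> - (e * norm (y - p)) \<le> J y - J p - v \<bullet> (y - p)"
  proof eventually_elim
    case (elim y)
    show ?case
    proof
      assume "y \<in> C"
      with elim(2) obtain u where u: "u \<in> T" "norm (y - p - u) \<le> c * norm (y - p)" by blast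
      have "\<bar>D p (y - p) - D p u\<bar> \<le> L * norm (y - p - u)"
        using lipschitz_onD[OF L] by (auto simp: dist_norm)
      also have "\<dots> \<le> L * (c * norm (y - p))"
        using u(2) \<open>L \<ge> 0\<close> by (rule mult_left_mono)
      finally have 1: "D p u - L * (c * norm (y - p)) \<le> D p (y - p)" by linarith
      have "\<bar>v \<bullet> (y - p - u)\<bar> \<le> norm v * norm (y - p - u)" by (rule Cauchy_Schwarz_ineq2)
      also have "\<dots> \<le> norm v * (c * norm (y - p))"
        using u(2) by (intro mult_left_mono) auto
      finally have 2: "v \<bullet> (y - p) \<le> v \<bullet> u + norm v * (c * norm (y - p))"
        by (simp add: inner_diff_right)
      have "- (K * (c * norm (y - p))) \<le> J y - J p - v \<bullet> (y - p)"
        using 1 2 elim(1) le[OF u(1)] by (simp add: K_def algebra_simps)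
      moreover have "K * (c * norm (y - p)) = e * norm (y - p)" using K by (simp add: c_def)
      ultimately show "- (e * norm (y - p)) \<le> J y - J p - v \<bullet> (y - p)" by simp
    qed
  qed
qed (rule \<open>p \<in> C\<close>)

text \<open>The image of a line under \<open>f\<close> is a curve in \<open>C\<close>. Its
  difference quotients come arbitrarily close to \<open>T\<close>, which is closed as a subspace of
  a finite-dimensional space, so their limit lies in \<open>T\<close>.\<close>

lemma derivative_in_tangent_space:
  assumes T: "tangent_space_at C (f y) T" and C: "range f \<subseteq> C"
    and f: "(f has_derivative f') (at y)"
  shows "f' w \<in> T"
proof -
  have "subspace T" using T by (simp add: tangent_space_at_def)
  define \<gamma> where "\<gamma> t = f (y + t *\<^sub>R w)" for t
  define q where "q t = (\<gamma> t - \<gamma> 0) /\<^sub>R t" for t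
  have \<gamma>: "(\<gamma> has_vector_derivative f' w) (at 0)"
    unfolding \<gamma>_def by (rule has_vector_derivative_along_line[OF f])
  have q: "(q \<longlongrightarrow> f' w) (at_right 0)"
    unfolding q_def by (rule has_vector_derivative_at_right_quotient[OF \<gamma>])
  have "(\<gamma> \<longlongrightarrow> \<gamma> 0) (at_right 0)"
    using has_vector_derivative_continuous[OF \<gamma>] by (auto simp: isCont_def intro: tendsto_within_subset)
  then have lim: "filterlim \<gamma> (nhds (f y)) (at_right 0)" by (simp add: \<gamma>_def)
  have "infdist (f' w) T \<le> 0"
  proof (rule le_if_le_add_small_multiple)
    fix e :: real assume "e > 0"
    then have "\<forall>\<^sub>F x in nhds (f y). x \<in> C \<longrightarrow> (\<exists>u\<in>T. norm (x - f y - u) \<le> e * norm (x - f y))"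
      using T unfolding tangent_space_at_def by blast
    from eventually_compose_filterlim[OF this lim] eventually_at_right_less
    have "\<forall>\<^sub>F t in at_right 0. infdist (q t) T \<le> 0 + e * norm (q t)"
    proof eventually_elim
      case (elim t)
      have "\<gamma> t \<in> C" using C by (auto simp: \<gamma>_def)
      with elim(1) obtain u where u: "u \<in> T" "norm (\<gamma> t - f y - u) \<le> e * norm (\<gamma> t - f y)" by blast
      have \<gamma>: "\<gamma> t - f y = t *\<^sub>R q t" using elim(2) by (simp add: q_def \<gamma>_def)
      have "u /\<^sub>R t \<in> T" using \<open>subspace T\<close> u(1) by (rule subspace_scale)
      have "t * dist (q t) (u /\<^sub>R t) = norm (t *\<^sub>R (q t - u /\<^sub>R t))"
        using elim(2) by (simp add: dist_norm)
      also have "\<dots> = norm (\<gamma> t - f y - u)"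
        using elim(2) by (simp add: \<gamma> algebra_simps)
      also have "\<dots> \<le> t * (e * norm (q t))"
        using u(2) elim(2) by (simp add: \<gamma> mult.left_commute)
      finally have "dist (q t) (u /\<^sub>R t) \<le> e * norm (q t)"
        using elim(2) by simp
      then show ?case
        using infdist_le2[OF \<open>u /\<^sub>R t \<in> T\<close>] by simp
    qed
    then show "infdist (f' w) T \<le> 0 + e * norm (f' w)"
      by (rule tendsto_le[OF trivial_limit_at_right_real _ _, rotated 2])
         (intro tendsto_intros q)+
  qed
  then have "infdist (f' w) T = 0" using infdist_nonneg by (rule antisym)
  moreover have "closed T" "T \<noteq> {}"
    using \<open>subspace T\<close> closed_subspace subspace_0 by auto
  ultimately show ?thesis using in_closed_iff_infdist_zero by blast
qed

subsection \<open>Tangent spaces of embedded submanifolds\<close>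

lemma linear_blinfun_apply: "linear (blinfun_apply f)"
  using blinfun.bounded_linear_right by (rule bounded_linear.linear)

text \<open>Inversion is continuous at an invertible map. The lower bound \<open>B\<close> for
  \<open>a\<close> controls the solutions of the perturbed equations
  \<open>h x (\<zeta> x) = w\<close>.\<close>

lemma tendsto_inv_blinfun:
  fixes a :: "'a::euclidean_space \<Rightarrow>\<^sub>L 'b::euclidean_space"
  assumes h: "(h \<longlongrightarrow> a) F" and bij: "\<forall>\<^sub>F x in F. bij (blinfun_apply (h x))"
    and a: "bij (blinfun_apply a)"
  shows "((\<lambda>x. inv (blinfun_apply (h x)) w) \<longlongrightarrow> inv (blinfun_apply a) w) F"
proof -
  obtain B where B: "B > 0" "\<And>z. B * norm z \<le> norm (a z)"
    using linear_inj_bounded_below_pos[of "blinfun_apply a"] a bij_is_inj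
    by (metis linear_blinfun_apply)
  define z where "z = inv (blinfun_apply a) w"
  define \<zeta> where "\<zeta> x = inv (blinfun_apply (h x)) w" for x
  have z: "a z = w" using a by (simp add: z_def bij_is_surj surj_f_inv_f)
  have "((\<lambda>x. norm (h x - a)) \<longlongrightarrow> 0) F"
    using h by (simp add: tendsto_norm_zero_iff LIM_zero_iff)
  then have small: "\<forall>\<^sub>F x in F. norm (h x - a) < B / 2"
    using B(1) by (intro order_tendstoD) auto
  have lim: "((\<lambda>x. norm (h x - a) * (2 * norm z / B)) \<longlongrightarrow> 0) F"
    using tendsto_mult_left_zero[OF \<open>((\<lambda>x. norm (h x - a)) \<longlongrightarrow> 0) F\<close>] .
  have "\<forall>\<^sub>F x in F. norm (\<zeta> x - z) \<le> norm (h x - a) * (2 * norm z / B)"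
    using small bij
  proof eventually_elim
    case (elim x)
    have "h x (\<zeta> x) = w" using elim(2) by (simp add: \<zeta>_def bij_is_surj surj_f_inv_f)
    then have "a (\<zeta> x - z) = - (h x - a) (\<zeta> x)"
      by (simp add: blinfun.diff_right blinfun.diff_left z)
    then have "B * norm (\<zeta> x - z) \<le> norm ((h x - a) (\<zeta> x))"
      using B(2)[of "\<zeta> x - z"] by simp
    also have "\<dots> \<le> norm (h x - a) * norm (\<zeta> x)" by (rule norm_blinfun)
    finally have 1: "B * norm (\<zeta> x - z) \<le> norm (h x - a) * norm (\<zeta> x)" .
    also have "\<dots> \<le> B / 2 * norm (\<zeta> x)"
      using elim(1) by (intro mult_right_mono) auto
    \<comment> \<open>A perturbation below \<open>B / 2\<close> bounds the perturbed solutions by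
      \<open>2 * norm z\<close>; inserted into estimate 1, this gives a bound that tends to
      0.\<close>
    finally have "2 * norm (\<zeta> x - z) \<le> norm (\<zeta> x)"
      using B(1) by simp
    then have "norm (\<zeta> x) \<le> 2 * norm z"
      using norm_triangle_sub[of "\<zeta> x" z] by linarith
    then have "B * norm (\<zeta> x - z) \<le> norm (h x - a) * (2 * norm z)"
      using 1 by (meson mult_left_mono norm_ge_zero order_trans)
    then show ?case using B(1) by (simp add: field_simps)
  qed
  then have "((\<lambda>x. \<zeta> x - z) \<longlongrightarrow> 0) F"
    using lim by (rule Lim_null_comparison)
  then show ?thesis unfolding \<zeta>_def z_def using LIM_zero_iff by blast
qed

text \<open>The chart \<Psi> straightens \<open>C\<close> to the subspace \<open>E\<close>. The
  curves are the images under \<open>G\<close> of lines in \<open>E\<close>, and continuity of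
  \<open>G'\<close> makes their directions converge; the approximation clause is the expansion of
  \<open>G\<close> at \<open>\<Psi> p\<close>.\<close>

lemma tangent_space_at_chart:
  fixes \<Psi> :: "'a::euclidean_space \<Rightarrow> 'b::euclidean_space"
  assumes "open U" "p \<in> U" "p \<in> C" "open V" and hom: "homeomorphism U V \<Psi> G"
    and E: "subspace E" and C: "\<And>x. x \<in> U \<Longrightarrow> x \<in> C \<longleftrightarrow> \<Psi> x \<in> E"
    and \<Psi>: "(\<Psi> has_derivative \<Psi>') (at p)"
    and G: "\<And>y. y \<in> V \<Longrightarrow> (G has_derivative G' y) (at y)"
    and G': "\<And>w. ((\<lambda>y. G' y w) \<longlongrightarrow> G' (\<Psi> p) w) (nhds (\<Psi> p))"
  shows "tangent_space_at C p (G' (\<Psi> p) ` E)"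
  unfolding tangent_space_at_def
proof (intro conjI ballI allI impI)
  have V: "\<Psi> x \<in> V" "G (\<Psi> x) = x" if "x \<in> U" for x
    using hom that by (auto simp: homeomorphism_def)
  have U: "G y \<in> U" "\<Psi> (G y) = y" if "y \<in> V" for y
    using hom that by (auto simp: homeomorphism_def)
  have Gp: "(G has_derivative G' (\<Psi> p)) (at (\<Psi> p))"
    using G V \<open>p \<in> U\<close> by blast
  then have "linear (G' (\<Psi> p))" by (rule has_derivative_linear)
  then show "subspace (G' (\<Psi> p) ` E)"
    using E by (rule linear_subspace_image)
  have \<Psi>lim: "(\<Psi> \<longlongrightarrow> \<Psi> p) (nhds p)"
    using has_derivative_continuous[OF \<Psi>] by (rule isCont_imp_tendsto_nhds)
  {
    fix u xs assume u: "u \<in> G' (\<Psi> p) ` E" and xs: "\<forall>n. xs n \<in> C" "xs \<longlonglongrightarrow> p"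
    then obtain w where w: "w \<in> E" "u = G' (\<Psi> p) w" by blast
    have "(\<lambda>n. \<Psi> (xs n)) \<longlonglongrightarrow> \<Psi> p"
      using \<Psi>lim xs(2) by (rule filterlim_compose)
    then have us: "(\<lambda>n. G' (\<Psi> (xs n)) w) \<longlonglongrightarrow> u"
      unfolding w(2) by (rule filterlim_compose[OF G'])
    have "\<forall>\<^sub>F n in sequentially. xs n \<in> U"
      using xs(2) \<open>open U\<close> \<open>p \<in> U\<close> by (rule topological_tendstoD)
    then have "\<forall>\<^sub>F n in sequentially. \<exists>\<gamma>. \<gamma> 0 = xs n \<and>
        (\<gamma> has_vector_derivative G' (\<Psi> (xs n)) w) (at 0) \<and> (\<forall>\<^sub>F t in at_right 0. \<gamma> t \<in> C)"
    proof eventually_elim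
      case (elim n)
      define y where "y = \<Psi> (xs n)"
      have y: "y \<in> V" "G y = xs n" "y \<in> E"
        using V[OF elim] C[OF elim] xs(1) by (auto simp: y_def)
      have der: "((\<lambda>t. G (y + t *\<^sub>R w)) has_vector_derivative G' y w) (at 0)"
        by (rule has_vector_derivative_along_line[OF G[OF y(1)]])
      have "((\<lambda>t. y + t *\<^sub>R w) \<longlongrightarrow> y + 0 *\<^sub>R w) (at_right 0)"
        by (intro tendsto_intros)
      then have "\<forall>\<^sub>F t in at_right 0. y + t *\<^sub>R w \<in> V"
        using \<open>open V\<close> y(1) by (intro topological_tendstoD) auto
      then have "\<forall>\<^sub>F t in at_right 0. G (y + t *\<^sub>R w) \<in> C"
      proof eventually_elim
        case (elim t)
        have "y + t *\<^sub>R w \<in> E" using E y(3) w(1) by (intro subspace_add subspace_scale)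
        then show ?case using C[OF U(1)[OF elim]] U(2)[OF elim] by simp
      qed
      then show ?case
        using der y(2) unfolding y_def[symmetric]
        by (intro exI[of _ "\<lambda>t. G (y + t *\<^sub>R w)"]) auto
    qed
    then show "\<exists>us. us \<longlonglongrightarrow> u \<and> (\<forall>\<^sub>F n in sequentially. \<exists>\<gamma>. \<gamma> 0 = xs n \<and>
        (\<gamma> has_vector_derivative us n) (at 0) \<and> (\<forall>\<^sub>F t in at_right 0. \<gamma> t \<in> C))"
      using us by blast
  }
  {
    fix e :: real assume e: "e > 0"
    obtain B where B: "B > 0" "\<And>z. norm (\<Psi>' z) \<le> norm z * B"
      using bounded_linear.pos_bounded[OF has_derivative_bounded_linear[OF \<Psi>]] by blast
    \<comment> \<open>\<open>M\<close> bounds the growth of \<Psi> near \<open>p\<close>: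
      \<open>B\<close> comes from its derivative, 1 from the remainder with tolerance 1.\<close>
    define M where "M = B + 1"
    have M: "M > 0" using B(1) by (simp add: M_def)
    have "e / M > 0" using e M by simp
    have pU: "\<forall>\<^sub>F y in nhds p. y \<in> U"
      using \<open>open U\<close> \<open>p \<in> U\<close> by (rule eventually_nhds_in_open)
    from pU has_derivative_eventually_le[OF \<Psi> zero_less_one]
      eventually_compose_filterlim[OF has_derivative_eventually_le[OF Gp \<open>e / M > 0\<close>] \<Psi>lim]
    show "\<forall>\<^sub>F y in nhds p. y \<in> C \<longrightarrow> (\<exists>u\<in>G' (\<Psi> p) ` E. norm (y - p - u) \<le> e * norm (y - p))"
    proof eventually_elim
      case (elim y)
      have "norm (\<Psi> y - \<Psi> p) \<le> norm (\<Psi>' (y - p)) + norm (\<Psi> y - \<Psi> p - \<Psi>' (y - p))"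
        using norm_triangle_sub by blast
      also have "\<dots> \<le> M * norm (y - p)"
        using elim(2) B(2)[of "y - p"] by (simp add: M_def algebra_simps)
      finally have "e / M * norm (\<Psi> y - \<Psi> p) \<le> e / M * (M * norm (y - p))"
        using \<open>e / M > 0\<close> by (intro mult_left_mono) auto
      also have "\<dots> = e * norm (y - p)" using M by simp
      finally have "norm (y - p - G' (\<Psi> p) (\<Psi> y - \<Psi> p)) \<le> e * norm (y - p)"
        using elim(3) V(2)[OF elim(1)] V(2)[OF \<open>p \<in> U\<close>] by simp
      moreover have "\<Psi> y - \<Psi> p \<in> E" if "y \<in> C"
        using that C[OF elim(1)] C[OF \<open>p \<in> U\<close>] \<open>p \<in> C\<close> E by (auto intro: subspace_diff)
      ultimately show ?case by blast
    qed
  }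
qed

text \<open>\<open>P\<close> is the orthogonal projection, written in an orthonormal basis of
  \<open>K\<close>. Its positivity is what later makes the derivative of the chart
  injective.\<close>

lemma exists_linear_projection:
  fixes K :: "'a::euclidean_space set"
  assumes "subspace K"
  obtains P where "linear P" "\<And>v. P v \<in> K" "\<And>v. v \<in> K \<Longrightarrow> P v = v" "\<And>v. v \<bullet> P v \<ge> 0"
proof -
  obtain B where B: "B \<subseteq> K" "pairwise orthogonal B" "\<And>b. b \<in> B \<Longrightarrow> norm b = 1"
      "independent B" "span B = K"
    using orthonormal_basis_subspace[OF assms] by metis
  have "finite B" using B(4) by (rule independent_imp_finite)
  define P where "P v = (\<Sum>b\<in>B. (v \<bullet> b) *\<^sub>R b)" for v
  show thesis
  proof
    show lin: "linear P"
      unfolding P_def by (rule linearI) (auto simp: inner_add_left scaleR_add_left sum.distrib scaleR_sum_right)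
    show "P v \<in> K" for v
      unfolding P_def using assms B(1) by (intro subspace_sum subspace_scale) auto
    show "v \<bullet> P v \<ge> 0" for v
      unfolding P_def by (auto simp: inner_sum_right intro!: sum_nonneg)
    have "P b = b" if "b \<in> B" for b
    proof -
      have "P b = (\<Sum>c\<in>B. if c = b then b else 0)"
        unfolding P_def
      proof (rule sum.cong)
        fix c assume "c \<in> B"
        show "(b \<bullet> c) *\<^sub>R c = (if c = b then b else 0)"
          using B(2) B(3)[OF that] \<open>c \<in> B\<close> that
          by (auto simp: pairwise_def orthogonal_def dot_square_norm)
      qed simp
      then show ?thesis using \<open>finite B\<close> that by simp
    qed
    then show "P v = v" if "v \<in> K" for v
      using linear_eq_on[OF lin linear_id, of v B] that B(5) by simp
  qed
qed

text \<open>With \<open>A = DH(p)\<close> and \<open>P\<close> a projection onto \<open>ker A\<close>, the map \<open>\<Psi> = A\<^sup>* \<circ> H + P\<close> is a local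
  diffeomorphism at \<open>p\<close>, because \<open>A\<^sup>* A + P\<close> is injective, and it carries \<open>C\<close> into \<open>ker A\<close>.\<close>

lemma embedded_submanifold_tangent_space:
  fixes C :: "'a::euclidean_space set"
  assumes "embedded_submanifold d C" and "p \<in> C"
  obtains T where "tangent_space_at C p T"
proof -
  obtain N W and H :: "'a \<Rightarrow> 'a" where N: "open N" "p \<in> N" and W: "subspace W" "dim W = DIM('a) - d"
    and HW: "H ` N \<subseteq> W" and C1: "continuously_differentiable_on N H"
    and CN: "C \<inter> N = {x \<in> N. H x = 0}"
    and dim: "dim (range (frechet_derivative H (at p))) = DIM('a) - d"
    using assms unfolding embedded_submanifold_def by blast
  obtain H' where H: "\<And>x. x \<in> N \<Longrightarrow> (H has_derivative blinfun_apply (H' x)) (at x)"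
    and H': "continuous_on N H'"
    using C1 unfolding continuously_differentiable_on_def by blast
  define A where "A = blinfun_apply (H' p)"
  have linA: "linear A" unfolding A_def by (rule linear_blinfun_apply)
  have HA: "(H has_derivative A) (at p)" using H[OF N(2)] by (simp add: A_def)
  \<comment> \<open>Difference quotients of \<open>H\<close> stay in the closed subspace
    \<open>W\<close>, hence so does the derivative. Equality of dimensions then gives
    \<open>range A = W\<close>, so every value of \<open>H\<close> on \<open>N\<close> lies in the
    range of \<open>A\<close>.\<close>
  have "range A \<subseteq> W"
  proof
    fix z assume "z \<in> range A"
    then obtain w where z: "z = A w" by blast
    from has_vector_derivative_at_right_quotient[OF has_vector_derivative_along_line[OF HA]]
    have lim: "((\<lambda>t. (H (p + t *\<^sub>R w) - H p) /\<^sub>R t) \<longlongrightarrow> A w) (at_right 0)"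
      by simp
    have "((\<lambda>t. p + t *\<^sub>R w) \<longlongrightarrow> p + 0 *\<^sub>R w) (at_right 0)"
      by (intro tendsto_intros)
    then have "\<forall>\<^sub>F t in at_right 0. p + t *\<^sub>R w \<in> N"
      using N by (intro topological_tendstoD) auto
    then have "\<forall>\<^sub>F t in at_right 0. (H (p + t *\<^sub>R w) - H p) /\<^sub>R t \<in> W"
      by eventually_elim (use HW N(2) W(1) in \<open>auto intro!: subspace_scale subspace_diff\<close>)
    from Lim_in_closed_set[OF closed_subspace[OF W(1)] this trivial_limit_at_right_real lim]
    show "z \<in> W" by (simp add: z)
  qed
  moreover have "frechet_derivative H (at p) = A"
    using frechet_derivative_at[OF HA] by simp
  ultimately have rangeA: "range A = W"
    using subspace_dim_equal[of "range A" W] W dim linA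
    by (simp add: linear_subspace_image)
  define K where "K = {v. A v = 0}"
  have K: "subspace K" unfolding K_def using linA by (rule linear_subspace_kernel)
  obtain P where P: "linear P" "\<And>v. P v \<in> K" "\<And>v. v \<in> K \<Longrightarrow> P v = v" "\<And>v. v \<bullet> P v \<ge> 0"
    using exists_linear_projection[OF K] by metis
  define B where "B = adjoint A"
  have linB: "linear B" unfolding B_def using linA by (rule adjoint_linear)
  have adj: "x \<bullet> B y = A x \<bullet> y" for x y
    unfolding B_def using linA by (simp add: adjoint_works)
  have BA: "A v = 0" if "B (A v) = 0" for v
    using adj[of v "A v"] that by simp
  define \<Psi> where "\<Psi> x = B (H x) + P x" for x
  define \<Psi>' where "\<Psi>' x = (Blinfun B o\<^sub>L H' x) + Blinfun P" for x
  have bl: "bounded_linear B" "bounded_linear P"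
    using linB P(1) by (auto simp: linear_conv_bounded_linear)
  have \<Psi>'_apply: "blinfun_apply (\<Psi>' x) = (\<lambda>v. B (H' x v) + P v)" for x
    by (simp add: \<Psi>'_def fun_eq_iff bl bounded_linear_Blinfun_apply blinfun.add_left)
  have \<Psi>: "(\<Psi> has_derivative blinfun_apply (\<Psi>' x)) (at x)" if "x \<in> N" for x
    unfolding \<Psi>_def \<Psi>'_apply
    by (intro has_derivative_add bounded_linear.has_derivative[OF bl(1)] H[OF that]
        bounded_linear_imp_has_derivative bl(2))
  have \<Psi>'_cont: "continuous_on N \<Psi>'"
    unfolding \<Psi>'_def by (intro continuous_intros H')
  have \<Psi>'p: "blinfun_apply (\<Psi>' p) v = B (A v) + P v" for v
    by (simp add: \<Psi>'_apply A_def)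
  \<comment> \<open>Pairing a kernel vector \<open>v\<close> with its image gives two nonnegative
    terms with sum 0. So \<open>A v = 0\<close>, hence \<open>P v = v\<close>, and
    \<open>v \<bullet> P v = 0\<close> forces \<open>v = 0\<close>.\<close>
  have "inj (blinfun_apply (\<Psi>' p))"
    unfolding linear_injective_0[OF linear_blinfun_apply]
  proof (intro allI impI)
    fix v assume "blinfun_apply (\<Psi>' p) v = 0"
    then have "v \<bullet> B (A v) + v \<bullet> P v = 0"
      by (metis \<Psi>'p inner_add_right inner_zero_right)
    then have "A v \<bullet> A v + v \<bullet> P v = 0" by (simp add: adj)
    moreover have "A v \<bullet> A v \<ge> 0" by simp
    ultimately have "A v \<bullet> A v = 0" "v \<bullet> P v = 0" using P(4)[of v] by linarith+
    then show "v = 0" using P(3)[of v] by (simp add: K_def)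
  qed
  then obtain h where h: "linear h" "h \<circ> blinfun_apply (\<Psi>' p) = id"
    using linear_injective_left_inverse[OF linear_blinfun_apply] by blast
  then have inv: "Blinfun h o\<^sub>L \<Psi>' p = id_blinfun"
    by (intro blinfun_eqI)
       (simp add: bounded_linear_Blinfun_apply linear_conv_bounded_linear fun_eq_iff)
  obtain U V G G' where UV: "open U" "U \<subseteq> N" "p \<in> U" "open V" "\<Psi> p \<in> V" "homeomorphism U V \<Psi> G"
    and G: "\<And>y. y \<in> V \<Longrightarrow> (G has_derivative (G' y)) (at y)"
      "\<And>y. y \<in> V \<Longrightarrow> G' y = Hilbert_Choice.inv (blinfun_apply (\<Psi>' (G y)))"
      "\<And>y. y \<in> V \<Longrightarrow> bij (blinfun_apply (\<Psi>' (G y)))"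
    using inverse_function_theorem[OF N(1) \<Psi> \<Psi>'_cont N(2) inv] by metis
  have Gp: "G (\<Psi> p) = p" using UV(3,6) by (auto simp: homeomorphism_def)
  have "isCont \<Psi>' p" using \<Psi>'_cont N by (simp add: continuous_on_eq_continuous_at)
  moreover have "isCont G (\<Psi> p)" using G(1)[OF UV(5)] has_derivative_continuous by blast
  ultimately have "isCont (\<lambda>y. \<Psi>' (G y)) (\<Psi> p)"
    using isCont_o2[of "\<Psi> p" G \<Psi>'] Gp by simp
  then have lim: "((\<lambda>y. \<Psi>' (G y)) \<longlongrightarrow> \<Psi>' (G (\<Psi> p))) (nhds (\<Psi> p))"
    by (rule isCont_imp_tendsto_nhds)
  have V: "\<forall>\<^sub>F y in nhds (\<Psi> p). y \<in> V" using UV(4,5) by (rule eventually_nhds_in_open)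
  \<comment> \<open>On \<open>V\<close>, \<open>G' y\<close> inverts \<open>\<Psi>' (G y)\<close>,
    which is continuous in \<open>y\<close> at \<open>\<Psi> p\<close>; continuity of inversion
    applies.\<close>
  have G': "((\<lambda>y. G' y w) \<longlongrightarrow> G' (\<Psi> p) w) (nhds (\<Psi> p))" for w
  proof (rule Lim_transform_eventually)
    show "((\<lambda>y. Hilbert_Choice.inv (blinfun_apply (\<Psi>' (G y))) w) \<longlongrightarrow> G' (\<Psi> p) w) (nhds (\<Psi> p))"
      unfolding G(2)[OF UV(5)]
      by (intro tendsto_inv_blinfun lim G(3) UV(5) eventually_mono[OF V])
    show "\<forall>\<^sub>F y in nhds (\<Psi> p). Hilbert_Choice.inv (blinfun_apply (\<Psi>' (G y))) w = G' y w"
      using V by eventually_elim (simp add: G(2))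
  qed
  have CK: "x \<in> C \<longleftrightarrow> \<Psi> x \<in> K" if "x \<in> U" for x
  proof -
    have "x \<in> N" using that UV(2) by blast
    then have "x \<in> C \<longleftrightarrow> H x = 0" using CN by blast
    moreover have "H x = 0" if "\<Psi> x \<in> K"
    proof -
      \<comment> \<open>Ranges of an adjoint are orthogonal to the kernel, so \<open>B (H x)\<close>
        vanishes once it lies in \<open>K\<close>; as \<open>H x\<close> has the form
        \<open>A v\<close>, this forces \<open>H x = 0\<close>.\<close>
      have "B (H x) \<in> K"
        using subspace_diff[OF K that P(2)[of x]] by (simp add: \<Psi>_def)
      then have "B (H x) \<bullet> B (H x) = 0" by (simp add: adj K_def)
      moreover obtain v where "H x = A v" using rangeA HW \<open>x \<in> N\<close> by blast
      ultimately show ?thesis using BA by simp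
    qed
    moreover have "\<Psi> x \<in> K" if "H x = 0"
      using that P(2) by (simp add: \<Psi>_def linear_0[OF linB])
    ultimately show ?thesis by blast
  qed
  show thesis
    using tangent_space_at_chart[OF UV(1,3) assms(2) UV(4,6) K CK \<Psi>[OF N(2)] G(1) G'] that by blast
qed

subsection \<open>Stationarity under parametrization\<close>

theorem theorem3p2:
  fixes C :: "'x::euclidean_space set"
    and d :: nat
    and F h :: "'x \<Rightarrow> real"
    and S :: "'x \<Rightarrow> 'z::euclidean_space"
    and g :: "'z \<Rightarrow> real"
    and \<phi> :: "'y::euclidean_space \<Rightarrow> 'x"
    and Lh Lg \<eta> :: real
    and xstar :: 'x and ystar :: 'y
  assumes "C \<noteq> {}" and "connected C" and "closed C" and "embedded_submanifold d C"
    and "F = (\<lambda>x. h x + g (S x))"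
    and "continuously_differentiable_on UNIV h"
    and "Lh > 0" and "Lh-lipschitz_on C (gradient h)"
    and "continuously_differentiable_on UNIV S"
    and "Lg > 0" and "Lg-lipschitz_on UNIV g"
    and "\<eta> > 0" and "weakly_convex \<eta> g"
    and "(INF x\<in>C. ereal (F x)) > - \<infinity>"
    and "continuously_differentiable_on UNIV \<phi>" and "range \<phi> = C"
    and "xstar = \<phi> ystar"
  shows "(0 \<in> limiting_subdifferential (\<lambda>x. ereal (F x) + set_indicator C x) xstar
            \<longrightarrow> 0 \<in> limiting_subdifferential (\<lambda>y. ereal (F (\<phi> y))) ystar)
       \<and> (kernel (adjoint (frechet_derivative \<phi> (at ystar))) \<subseteq> normal_cone C xstar
            \<longrightarrow> 0 \<in> limiting_subdifferential (\<lambda>y. ereal (F (\<phi> y))) ystar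
            \<longrightarrow> 0 \<in> limiting_subdifferential (\<lambda>x. ereal (F x) + set_indicator C x) xstar)"
proof -
  obtain h' where h: "\<And>x. (h has_derivative blinfun_apply (h' x)) (at x)" "continuous_on UNIV h'"
    using assms(6) unfolding continuously_differentiable_on_def by blast
  obtain S' where S: "\<And>x. (S has_derivative blinfun_apply (S' x)) (at x)" "continuous_on UNIV S'"
    using assms(9) unfolding continuously_differentiable_on_def by blast
  obtain \<phi>' where \<phi>: "\<And>y. (\<phi> has_derivative blinfun_apply (\<phi>' y)) (at y)" "continuous_on UNIV \<phi>'"
    using assms(15) unfolding continuously_differentiable_on_def by blast
  obtain Dg where "has_usc_B_derivative g Dg"
    using weakly_convex_has_usc_B_derivative[OF assms(13)] by blast
  from has_usc_B_derivative_add[OF has_usc_B_derivative_C1[OF h] has_usc_B_derivative_compose[OF this S]]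
  obtain D where F: "has_usc_B_derivative F D" unfolding assms(5) by blast
  note F\<phi> = has_usc_B_derivative_compose[OF F \<phi>]
  have "xstar \<in> C" using assms(16,17) by blast
  obtain T where T: "tangent_space_at C xstar T"
    using embedded_submanifold_tangent_space[OF assms(4) \<open>xstar \<in> C\<close>] by blast
  \<comment> \<open>Adding the zero indicator brings the composition into the constrained form of
    the preceding lemmas.\<close>
  have unconstrained: "(\<lambda>y. ereal (F (\<phi> y))) = (\<lambda>y. ereal (F (\<phi> y)) + set_indicator UNIV y)"
    by (simp add: set_indicator_def)
  have range_T: "\<phi>' ystar w \<in> T" for w
    using derivative_in_tangent_space[of C \<phi> ystar T] T assms(16,17) \<phi>(1) by simp
  show ?thesis
  proof (intro conjI impI)
    assume "0 \<in> limiting_subdifferential (\<lambda>x. ereal (F x) + set_indicator C x) xstar"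
    then have "0 \<le> D (\<phi> ystar) (\<phi>' ystar w)" for w
      using limiting_subgradient_le[OF F T _ range_T, of 0 w] assms(17) by simp
    then have "0 \<in> frechet_subdifferential (\<lambda>y. ereal (F (\<phi> y))) ystar"
      unfolding unconstrained
      by (intro frechet_subdifferentialI[OF F\<phi> tangent_space_at_UNIV]) auto
    then show "0 \<in> limiting_subdifferential (\<lambda>y. ereal (F (\<phi> y))) ystar"
      using frechet_subset_limiting_subdifferential by blast
  next
    assume ker: "kernel (adjoint (frechet_derivative \<phi> (at ystar))) \<subseteq> normal_cone C xstar"
      and "0 \<in> limiting_subdifferential (\<lambda>y. ereal (F (\<phi> y))) ystar"
    then have nonneg: "0 \<le> D xstar (\<phi>' ystar w)" for w
      using limiting_subgradient_le[OF F\<phi> tangent_space_at_UNIV, of 0 ystar w] assms(17)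
      unfolding unconstrained by simp
    have adj: "w \<bullet> adjoint (\<phi>' ystar) z = \<phi>' ystar w \<bullet> z" for w z
      by (rule adjoint_works[OF linear_blinfun_apply])
    have "0 \<le> D xstar u" if u: "u \<in> T" for u
    proof -
      \<comment> \<open>The goal is \<open>b = 0\<close>. The part \<open>b\<close> orthogonal to
        the range of the derivative lies in the kernel of its adjoint, hence in the normal cone by
        assumption.\<close>
      obtain a b where a: "a \<in> span (range (blinfun_apply (\<phi>' ystar)))"
        and b: "\<And>w. w \<in> span (range (blinfun_apply (\<phi>' ystar))) \<Longrightarrow> orthogonal b w" and u_eq: "u = a + b"
        using orthogonal_subspace_decomp_exists by metis
      have "w \<bullet> adjoint (\<phi>' ystar) b = 0" for w
        using b[of "\<phi>' ystar w"] by (simp add: adj span_base orthogonal_def inner_commute)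
      then have "adjoint (\<phi>' ystar) b = 0"
        by (metis inner_eq_zero_iff)
      then have "b \<in> normal_cone C xstar"
        using ker frechet_derivative_at[OF \<phi>(1)[of ystar]] by (auto simp: kernel_def)
      then have "b \<in> limiting_subdifferential (\<lambda>x. ereal 0 + set_indicator C x) xstar"
        by (simp add: normal_cone_def)
      \<comment> \<open>With the zero function as objective, the subgradient inequality says that
        normal vectors have nonpositive inner product with \<open>T\<close>. Since
        \<open>b \<bullet> u = b \<bullet> b\<close>, this gives \<open>b = 0\<close> and
        \<open>u = a\<close>.\<close>
      moreover have "has_usc_B_derivative (\<lambda>x::'x. 0) (\<lambda>x u. blinfun_apply (0 :: 'x \<Rightarrow>\<^sub>L real) u)"
        by (rule has_usc_B_derivative_C1[of _ "\<lambda>_. 0"]) (auto simp: zero_blinfun.rep_eq)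
      ultimately have "b \<bullet> u \<le> 0"
        using limiting_subgradient_le[OF _ T _ u] by fastforce
      then have "b \<bullet> b \<le> 0"
        using b[OF a] by (simp add: u_eq inner_add_right orthogonal_def)
      then have "b = 0" by (metis inner_ge_zero inner_eq_zero_iff order_antisym)
      moreover have "a \<in> range (blinfun_apply (\<phi>' ystar))"
        using a linear_subspace_image[OF linear_blinfun_apply subspace_UNIV] span_eq_iff by blast
      ultimately show ?thesis using nonneg u_eq by auto
    qed
    then have "0 \<in> frechet_subdifferential (\<lambda>x. ereal (F x) + set_indicator C x) xstar"
      by (intro frechet_subdifferentialI[OF F T \<open>xstar \<in> C\<close>]) simp
    then show "0 \<in> limiting_subdifferential (\<lambda>x. ereal (F x) + set_indicator C x) xstar"
      using frechet_subset_limiting_subdifferential by blast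
  qed
qed

end
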